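(* Let $\Gamma$ be a group and $\phi:\Gamma\to\mathbb{C}^\times$ a group homomorphism. (1) Let $(V,\{Y_\alpha\}_{\alpha\in\Gamma},\mathbf 1)$ be a $\Gamma$-vertex algebra and for $\alpha\in\Gamma$ define $R_\alpha$ on $V$ by $R_\alpha(v)=\operatorname{Res}_x x^{-1}Y_\alpha(v,x)\mathbf 1=\lim_{x\to0}Y_\alpha(v,x)\mathbf 1$ for $v\in V$. Then $(V,Y_1,\mathbf 1)$ is a vertex algebra and the map $\alpha\mapsto R_\alpha$ is a representation of $\Gamma$ on $V$ with $R_\alpha(\mathbf 1)=\mathbf 1$ for $\alpha\in\Gamma$. Furthermore, $$Y_\alpha(v,x)=R_\alpha Y_1(v,x)R_{\alpha^{-1}}=Y_1(R_\alpha v,\alpha^{-1}x)\quad\text{for }\alpha\in\Gamma,\ v\in V.$$ (2) Conversely, let $(V,Y,\mathbf 1)$ be an (ordinary) vertex algebra. Assume that $V$ is a $\Gamma$-module with $\alpha\in\Gamma$ acting as a linear automorphism $R_\alpha$ of $V$ such that $R_\alpha(\mathbf 1)=\mathbf 1$ and $$R_\alpha Y(v,x)R_\alpha^{-1}=Y(R_\alpha(v),\alpha^{-1}x)\quad\text{for }\alpha\in\Gamma,\ v\in V.$$ For $\alpha\in\Gamma$ define $Y_\alpha:V\to(\operatorname{End}V)[[x,x^{-1}]]$ by $$Y_\alpha(v,x)=R_\alpha Y(v,x)R_\alpha^{-1}=Y(R_\alpha(v),\alpha^{-1}x)\quad\text{for }v\in V.$$ Then $(V,\{Y_\alpha\}_{\alpha\in\Gamma},\mathbf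 1)$ is a $\Gamma$-vertex algebra.
   Context: All vector spaces are over $\mathbb{C}$; $x,x_0,x_1,x_2$ are commuting formal variables; $V((x))$ is the space of lower truncated Laurent series. $\Gamma$ is an arbitrary group (possibly nonabelian or infinite) with identity denoted $1$, with fixed homomorphism $\phi:\Gamma\to\mathbb{C}^\times$; whenever an element $\alpha\in\Gamma$ multiplies a formal variable, as in $\alpha x$, it means $\phi(\alpha)x$. $\delta(z)=\sum_{n\in\mathbb{Z}}z^n$; integer powers of a binomial are expanded in nonnegative powers of the second-written term. $\Gamma$-vertex algebra: a vector space $V$ with linear maps $Y_\alpha:V\to\operatorname{Hom}(V,V((x)))$, $\alpha\in\Gamma$, and a vector $\mathbf 1\in V$ such that for $\alpha,\beta\in\Gamma$, $u,v\in V$: $Y_\alpha(\mathbf 1,x)=1$; $Y_\alpha(v,x)\mathbf 1\in V[[x]]$; $\lim_{x\to 0}Y_1(v,x)\mathbf 1=v$; and $$x_0^{-1}\delta\left(\tfrac{x_1-\beta^{-1}\alpha x_2}{x_0}\right)Y_\alpha(u,x_1)Y_\beta(v,x_2)-x_0^{-1}\delta\left(\tfrac{-\beta^{-1}\alpha x_2+x_1}{x_0}\right)Y_\beta(v,x_2)Y_\alpha(u,x_1)=x_1^{-1}\delta\left(\tfrac{\beta^{-1}\alpha x_2+x_0}{x_1}\right)Y_\beta(Y_{\beta^{-1}\alpha}(u,x_0)v,x_2).$$ A vertex algebra $(V,Y,\mathbf 1)$ is the case $\Gamma=\{1\}$ of this definition. *)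

theory Defs
  imports
    Complex_Main
    "HOL-Algebra.Elementary_Groups"
    "HOL-Library.Groups_Big_Fun"
    "HOL-Library.Product_Plus"
begin

text \<open>
  A doubly infinite formal series over \<open>'a\<close> in one variable is its coefficient function
  \<open>int \<Rightarrow> 'a\<close>, the value at \<open>n\<close> being the coefficient of \<open>x\<^sup>n\<close> (not the mode indexed
  by \<open>x\<close> to the power \<open>- n - 1\<close>). An element of (End V)[[x, 1/x]] has type
  \<open>int \<Rightarrow> 'v \<Rightarrow> 'v\<close>, the linearity of its coefficients being required separately. A series in
  \<open>x\<^sub>0, x\<^sub>1, x\<^sub>2\<close> is a function of the exponent triple.
\<close>

type_synonym 'a series = "int \<Rightarrow> 'a"
type_synonym 'a series3 = "int \<times> int \<times> int \<Rightarrow> 'a"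

definition lower_truncated :: "'v::zero series \<Rightarrow> bool" where
  "lower_truncated f \<longleftrightarrow> (\<exists>N. \<forall>n<N. f n = 0)"

definition power_series :: "'v::zero series \<Rightarrow> bool" where
  "power_series f \<longleftrightarrow> (\<forall>n<0. f n = 0)"

text \<open>The limit at \<open>x = 0\<close> exists only for series without negative powers of \<open>x\<close>.\<close>

definition has_formal_limit :: "'v::zero series \<Rightarrow> 'v \<Rightarrow> bool" where
  "has_formal_limit f L \<longleftrightarrow> power_series f \<and> f 0 = L"

definition Res :: "'v series \<Rightarrow> 'v" where
  "Res f = f (- 1)"

definition shift :: "int \<Rightarrow> 'v series \<Rightarrow> 'v series" \<comment> \<open>multiplication by \<open>x\<^sup>k\<close>\<close> where
  "shift k f = (\<lambda>n. f (n - k))"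

definition dilate :: "(complex \<Rightarrow> 'v \<Rightarrow> 'v) \<Rightarrow> complex \<Rightarrow> ('v \<Rightarrow> 'v) series \<Rightarrow> ('v \<Rightarrow> 'v) series"
    \<comment> \<open>the substitution of \<open>c x\<close> for \<open>x\<close>\<close> where
  "dilate scale c a = (\<lambda>n w. scale (c powi n) (a n w))"

definition conjugate :: "('v \<Rightarrow> 'v) \<Rightarrow> ('v \<Rightarrow> 'v) series \<Rightarrow> ('v \<Rightarrow> 'v) \<Rightarrow> ('v \<Rightarrow> 'v) series" where
  "conjugate A a B = (\<lambda>n. A \<circ> a n \<circ> B)"

definition Hom_Laurent ::
    "(complex \<Rightarrow> 'v \<Rightarrow> 'v) \<Rightarrow> ('v::ab_group_add \<Rightarrow> 'v) series set" \<comment> \<open>\<open>Hom(V, V((x)))\<close>\<close> where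
  "Hom_Laurent scale =
     {a. (\<forall>n. Vector_Spaces.linear scale scale (a n)) \<and> (\<forall>w. lower_truncated (\<lambda>n. a n w))}"

text \<open>The coefficient of \<open>z\<^sup>i w\<^sup>j\<close> in \<open>(a z + b w)\<^sup>n\<close>, expanded in nonnegative powers of \<open>b w\<close>;
  here \<open>a\<close> is nonzero.\<close>

definition binomial_coeff :: "complex \<Rightarrow> complex \<Rightarrow> int \<Rightarrow> int \<Rightarrow> int \<Rightarrow> complex" where
  "binomial_coeff a b n i j =
     (if 0 \<le> j \<and> i + j = n then (of_int n gchoose nat j) * a powi i * b ^ nat j else 0)"

text \<open>The coefficient of \<open>u\<^sup>l z\<^sup>i w\<^sup>j\<close> in \<open>(1/u) \<delta>((a z + b w)/u)\<close>, which is the sum over all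
  integers \<open>n\<close> of \<open>(a z + b w)\<^sup>n\<close> times \<open>u\<close> to the power \<open>- n - 1\<close>; only \<open>n = - l - 1\<close>
  contributes.\<close>

definition delta_coeff :: "complex \<Rightarrow> complex \<Rightarrow> int \<Rightarrow> int \<Rightarrow> int \<Rightarrow> complex" where
  "delta_coeff a b l i j = binomial_coeff a b (- l - 1) i j"

text \<open>The product of a scalar series and a vector series. Each coefficient is meant to be a finite
  sum, and \<open>Sum_any\<close> would return 0 on infinite support; in the Jacobi identity below the support
  is finite because all vertex operators are lower truncated on each vector.\<close>

definition series3_mult ::
    "(complex \<Rightarrow> 'v \<Rightarrow> 'v) \<Rightarrow> complex series3 \<Rightarrow> 'v::comm_monoid_add series3 \<Rightarrow> 'v series3" where
  "series3_mult scale D F = (\<lambda>p. Sum_any (\<lambda>q. scale (D q) (F (p - q))))"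

text \<open>For \<open>A\<close>, \<open>B\<close>, \<open>C\<close>, \<open>D\<close> and a scalar \<open>c\<close>, the identity obtained by applying both sides of
  \[ x_0^{-1}\delta\left(\frac{x_1-c x_2}{x_0}\right)A(x_1)B(x_2)
   - x_0^{-1}\delta\left(\frac{-c x_2+x_1}{x_0}\right)B(x_2)A(x_1)
   = x_1^{-1}\delta\left(\frac{c x_2+x_0}{x_1}\right) Y(C(x_0)v,x_2) \]
  to all vectors \<open>w\<close>, where \<open>Y\<close> is extended coefficientwise to the series \<open>C(x\<^sub>0)v\<close>.\<close>

definition jacobi_identity ::
    "(complex \<Rightarrow> 'v \<Rightarrow> 'v) \<Rightarrow> complex \<Rightarrow> ('v \<Rightarrow> 'v) series \<Rightarrow> ('v \<Rightarrow> 'v) series \<Rightarrow>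
     ('v \<Rightarrow> ('v \<Rightarrow> 'v) series) \<Rightarrow> ('v \<Rightarrow> 'v) series \<Rightarrow> 'v::ab_group_add \<Rightarrow> bool" where
  "jacobi_identity scale c A B Y C v \<longleftrightarrow>
     (\<forall>w p.
        series3_mult scale (\<lambda>(n\<^sub>0, n\<^sub>1, n\<^sub>2). delta_coeff 1 (- c) n\<^sub>0 n\<^sub>1 n\<^sub>2)
          (\<lambda>(n\<^sub>0, n\<^sub>1, n\<^sub>2). if n\<^sub>0 = 0 then A n\<^sub>1 (B n\<^sub>2 w) else 0) p
        - series3_mult scale (\<lambda>(n\<^sub>0, n\<^sub>1, n\<^sub>2). delta_coeff (- c) 1 n\<^sub>0 n\<^sub>2 n\<^sub>1)
          (\<lambda>(n\<^sub>0, n\<^sub>1, n\<^sub>2). if n\<^sub>0 = 0 then B n\<^sub>2 (A n\<^sub>1 w) else 0) p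
        = series3_mult scale (\<lambda>(n\<^sub>0, n\<^sub>1, n\<^sub>2). delta_coeff c 1 n\<^sub>1 n\<^sub>2 n\<^sub>0)
          (\<lambda>(n\<^sub>0, n\<^sub>1, n\<^sub>2). if n\<^sub>1 = 0 then Y (C n\<^sub>0 v) n\<^sub>2 w else 0) p)"

definition complex_units :: "complex monoid" where
  "complex_units = \<lparr>carrier = UNIV - {0}, monoid.mult = (*), one = 1\<rparr>"

definition GL :: "(complex \<Rightarrow> 'v \<Rightarrow> 'v) \<Rightarrow> ('v::ab_group_add \<Rightarrow> 'v) monoid" where
  "GL scale =
     \<lparr>carrier = {f. Vector_Spaces.linear scale scale f \<and> bij f}, monoid.mult = (\<circ>), one = id\<rparr>"

definition representation ::
    "('g, 'r) monoid_scheme \<Rightarrow> (complex \<Rightarrow> 'v \<Rightarrow> 'v) \<Rightarrow> ('g \<Rightarrow> 'v::ab_group_add \<Rightarrow> 'v) \<Rightarrow> bool" where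
  "representation \<Gamma> scale R \<longleftrightarrow> R \<in> hom \<Gamma> (GL scale)"

locale gamma_vertex_algebra =
  group \<Gamma> + vector_space scale
  for \<Gamma> :: "('g, 'r) monoid_scheme" (structure)
    and \<phi> :: "'g \<Rightarrow> complex"
    and scale :: "complex \<Rightarrow> 'v::ab_group_add \<Rightarrow> 'v"
    and Y :: "'g \<Rightarrow> 'v \<Rightarrow> ('v \<Rightarrow> 'v) series"
    and vac :: 'v +
  assumes char_hom: "\<phi> \<in> hom \<Gamma> complex_units"
    and Y_in: "\<alpha> \<in> carrier \<Gamma> \<Longrightarrow> Y \<alpha> v \<in> Hom_Laurent scale"
    and Y_linear: "\<alpha> \<in> carrier \<Gamma> \<Longrightarrow> Vector_Spaces.linear scale scale (\<lambda>v. Y \<alpha> v n w)"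
    and vacuum: "\<alpha> \<in> carrier \<Gamma> \<Longrightarrow> Y \<alpha> vac n w = (if n = 0 then w else 0)"
    and creation: "\<alpha> \<in> carrier \<Gamma> \<Longrightarrow> power_series (\<lambda>n. Y \<alpha> v n vac)"
    and creation_limit: "has_formal_limit (\<lambda>n. Y \<one> v n vac) v"
    and jacobi:
      "\<lbrakk>\<alpha> \<in> carrier \<Gamma>; \<beta> \<in> carrier \<Gamma>\<rbrakk> \<Longrightarrow>
       jacobi_identity scale (\<phi> (inv \<beta> \<otimes> \<alpha>)) (Y \<alpha> u) (Y \<beta> v) (Y \<beta>) (Y (inv \<beta> \<otimes> \<alpha>) u) v"

definition vertex_algebra ::
    "(complex \<Rightarrow> 'v \<Rightarrow> 'v) \<Rightarrow> ('v \<Rightarrow> ('v \<Rightarrow> 'v) series) \<Rightarrow> 'v::ab_group_add \<Rightarrow> bool" where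
  "vertex_algebra scale Y vac \<longleftrightarrow>
     gamma_vertex_algebra (singleton_group ()) (\<lambda>_. 1) scale (\<lambda>_. Y) vac"

definition vacuum_action :: "('g \<Rightarrow> 'v \<Rightarrow> ('v \<Rightarrow> 'v) series) \<Rightarrow> 'v \<Rightarrow> 'g \<Rightarrow> 'v \<Rightarrow> 'v" where
  "vacuum_action Y vac \<alpha> v = Res (shift (- 1) (\<lambda>n. Y \<alpha> v n vac))"

end

theory Submission
  imports Defs
begin

text \<open>
  In this outline \<open>\<one>\<close> is the vacuum, and \<open>\<alpha>\<close> stands for \<open>\<phi> \<alpha>\<close> wherever it is used as a scalar.

  From a \<open>\<Gamma>\<close>-vertex algebra to a representation, write \<open>R\<^sub>\<alpha> v\<close> for the constant term of
  \<open>Y\<^sub>\<alpha>(v, x) \<one>\<close>. Taking \<open>Res\<close> with respect to \<open>x\<^sub>1\<close> in the Jacobi identity for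
  \<open>Y\<^sub>\<alpha>(u, x\<^sub>1)\<close> and \<open>Y\<^sub>\<beta>(v, x\<^sub>2)\<close> isolates \<open>Y\<^sub>\<beta>(Y\<^bsub>\<beta>\<inverse>\<alpha>\<^esub>(u, x\<^sub>0) v, x\<^sub>2)\<close>, and two
  specialisations carry everything.
  For \<open>v = \<one>\<close> and \<open>x\<^sub>0 = 0\<close> it reads \<open>Y\<^sub>\<beta>(R\<^bsub>\<beta>\<inverse>\<alpha>\<^esub> u, x) = Y\<^sub>\<alpha>(u, \<beta>\<inverse>\<alpha> x)\<close>
  (\<open>Y_vacuum_action\<close>): its value on \<open>\<one>\<close> at \<open>x = 0\<close> says that \<open>R\<close> is multiplicative, and
  \<open>\<beta> = 1\<close> expresses \<open>Y\<^sub>\<alpha>\<close> by a dilation of \<open>Y\<^sub>1\<close>. Applied to \<open>\<one>\<close> at \<open>x\<^sub>2 = 0\<close> it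
  reads \<open>R\<^sub>\<beta> Y\<^bsub>\<beta>\<inverse>\<alpha>\<^esub>(u, x) = Y\<^sub>\<alpha>(u, x) R\<^sub>\<beta>\<close> (\<open>vacuum_action_intertwines\<close>), which for
  \<open>\<beta> = \<alpha>\<close> expresses \<open>Y\<^sub>\<alpha>\<close> by a conjugate of \<open>Y\<^sub>1\<close>.

  Conversely, the Jacobi identity with parameter 1 turns into the one with parameter \<open>b / a\<close> under
  the substitution of \<open>a x\<^sub>0\<close>, \<open>a x\<^sub>1\<close>, \<open>b x\<^sub>2\<close> for \<open>x\<^sub>0\<close>, \<open>x\<^sub>1\<close>, \<open>x\<^sub>2\<close>
  (\<open>jacobi_identity_dilate\<close>). With \<open>a = \<alpha>\<inverse>\<close> and \<open>b = \<beta>\<inverse>\<close> the parameter is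
  \<open>\<beta>\<inverse>\<alpha>\<close>, and the covariance of \<open>Y\<close> under \<open>R\<close> identifies the dilated inner
  series \<open>Y(R\<^sub>\<alpha> u, \<alpha>\<inverse> x) R\<^sub>\<beta> v\<close> with \<open>R\<^sub>\<beta> Y\<^bsub>\<beta>\<inverse>\<alpha>\<^esub>(u, x) v\<close>.
\<close>

section \<open>Coefficients of the Jacobi identity\<close>

lemma Sum_any_single:
  assumes "\<And>q. q \<noteq> r \<Longrightarrow> g q = 0"
  shows "Sum_any g = g r"
  using Sum_any.expand_superset[of "{r}" g] assms by auto

lemma linear_scale_eq: "Vector_Spaces.linear s s f \<Longrightarrow> f (s k x) = s k (f x)"
  by (simp add: Vector_Spaces.linear_iff)

lemma series3_mult_single:
  assumes "\<And>q. q \<noteq> r \<Longrightarrow> scale (D q) (F (p - q)) = 0"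
  shows "series3_mult scale D F p = scale (D r) (F (p - r))"
  unfolding series3_mult_def by (rule Sum_any_single) (rule assms)

lemma delta_coeff_eq_0: "\<not> (0 \<le> j \<and> i + j = - l - 1) \<Longrightarrow> delta_coeff a b l i j = 0"
  by (auto simp: delta_coeff_def binomial_coeff_def)

lemma gbinomial_neg_one: "(- 1 :: complex) gchoose k = (- 1) ^ k"
  by (simp add: gbinomial_minus binomial_gbinomial[symmetric])

text \<open>The coefficients of \<open>z\<^sup>-\<^sup>1\<^sup>-\<^sup>n w\<^sup>n\<close> in \<open>(z - c w)\<^sup>-\<^sup>1\<close> and \<open>(- c w + z)\<^sup>-\<^sup>1\<close> are \<open>c\<^sup>n\<close> for
  \<open>0 \<le> n\<close> and \<open>- c\<^sup>n\<close> for \<open>n < 0\<close>. Hence the difference of the two expansions is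
  \<open>z\<^sup>-\<^sup>1 \<delta>(c w / z)\<close>.\<close>

lemma delta_coeff_residue_left:
  "delta_coeff 1 (- c) 0 (- 1 - n) n = (if 0 \<le> n then c powi n else 0)"
  by (auto simp: delta_coeff_def binomial_coeff_def gbinomial_neg_one power_int_nonneg_exp
      power_mult_distrib[symmetric])

lemma delta_coeff_residue_right:
  assumes "c \<noteq> 0"
  shows "delta_coeff (- c) 1 0 n (- 1 - n) = (if n < 0 then - (c powi n) else 0)"
proof (cases "n < 0")
  case True
  define k where "k = nat (- 1 - n)"
  have n: "n = - int (Suc k)" using True by (simp add: k_def)
  have "delta_coeff (- c) 1 0 n (- 1 - n) = (- 1) ^ k * (- c) powi n"
    using True by (simp add: delta_coeff_def binomial_coeff_def gbinomial_neg_one k_def)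
  also have "\<dots> = - (c powi n)"
    unfolding n power_int_minus power_int_of_nat
    by (simp add: power_minus[of c] field_simps)
  finally show ?thesis using True by simp
qed (simp add: delta_coeff_def binomial_coeff_def)

context
  fixes scale :: "complex \<Rightarrow> 'v::ab_group_add \<Rightarrow> 'v"
  assumes vs: "vector_space scale"
begin

interpretation vector_space scale by (fact vs)

text \<open>The coefficient of \<open>x\<^sub>1\<^sup>-\<^sup>1\<close> on the right-hand side of the Jacobi identity is the iterate
  itself.\<close>

lemma series3_mult_iterate_residue:
  "series3_mult scale (\<lambda>(n\<^sub>0, n\<^sub>1, n\<^sub>2). delta_coeff c 1 n\<^sub>1 n\<^sub>2 n\<^sub>0)
     (\<lambda>(n\<^sub>0, n\<^sub>1, n\<^sub>2). if n\<^sub>1 = 0 then G n\<^sub>0 n\<^sub>2 else 0) (p\<^sub>0, - 1, p\<^sub>2) = G p\<^sub>0 p\<^sub>2"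
proof -
  have "series3_mult scale (\<lambda>(n\<^sub>0, n\<^sub>1, n\<^sub>2). delta_coeff c 1 n\<^sub>1 n\<^sub>2 n\<^sub>0)
     (\<lambda>(n\<^sub>0, n\<^sub>1, n\<^sub>2). if n\<^sub>1 = 0 then G n\<^sub>0 n\<^sub>2 else 0) (p\<^sub>0, - 1, p\<^sub>2)
     = scale (delta_coeff c 1 (- 1) 0 0) (G p\<^sub>0 p\<^sub>2)"
  proof (subst series3_mult_single[where r = "(0, - 1, 0)"], goal_cases)
    case (1 q)
    obtain q\<^sub>0 q\<^sub>1 q\<^sub>2 where q: "q = (q\<^sub>0, q\<^sub>1, q\<^sub>2)" by (cases q)
    show ?case
    proof (cases "q\<^sub>1 = - 1 \<and> 0 \<le> q\<^sub>0 \<and> q\<^sub>2 + q\<^sub>0 = 0")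
      case True
      \<comment> \<open>\<open>(c x\<^sub>2 + x\<^sub>0)\<^sup>0\<close> has only its constant term\<close>
      hence "delta_coeff c 1 q\<^sub>1 q\<^sub>2 q\<^sub>0 = 0"
        using 1 by (auto simp: q delta_coeff_def binomial_coeff_def gbinomial_0_left)
      then show ?thesis by (simp add: q)
    qed (auto simp: q delta_coeff_eq_0)
  qed simp
  then show ?thesis by (simp add: delta_coeff_def binomial_coeff_def)
qed

text \<open>The two products on the left-hand side of the Jacobi identity at
  \<open>x\<^sub>0\<^sup>0 x\<^sub>1\<^sup>-\<^sup>1 x\<^sub>2\<^sup>n\<close> when the operator in \<open>x\<^sub>2\<close> is the identity.\<close>

lemma series3_mult_left_residue:
  "series3_mult scale (\<lambda>(n\<^sub>0, n\<^sub>1, n\<^sub>2). delta_coeff 1 (- c) n\<^sub>0 n\<^sub>1 n\<^sub>2)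
     (\<lambda>(n\<^sub>0, n\<^sub>1, n\<^sub>2). if n\<^sub>0 = 0 then (if n\<^sub>2 = 0 then G n\<^sub>1 else 0) else 0) (0, - 1, n)
   = (if 0 \<le> n then scale (c powi n) (G n) else 0)"
proof (subst series3_mult_single[where r = "(0, - 1 - n, n)"], goal_cases)
  case (1 q)
  then show ?case
    by (cases q) (auto simp: delta_coeff_eq_0)
qed (simp add: delta_coeff_residue_left)

lemma series3_mult_right_residue:
  assumes "c \<noteq> 0"
  shows "series3_mult scale (\<lambda>(n\<^sub>0, n\<^sub>1, n\<^sub>2). delta_coeff (- c) 1 n\<^sub>0 n\<^sub>2 n\<^sub>1)
     (\<lambda>(n\<^sub>0, n\<^sub>1, n\<^sub>2). if n\<^sub>0 = 0 then (if n\<^sub>2 = 0 then G n\<^sub>1 else 0) else 0) (0, - 1, n)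
   = (if n < 0 then - scale (c powi n) (G n) else 0)"
proof (subst series3_mult_single[where r = "(0, - 1 - n, n)"], goal_cases)
  case (1 q)
  then show ?case
    by (cases q) (auto simp: delta_coeff_eq_0)
qed (use assms in \<open>simp add: delta_coeff_residue_right\<close>)

section \<open>Dilation of the Jacobi identity\<close>

text \<open>No finiteness is needed: scaling by \<open>k \<noteq> 0\<close> does not change the support.\<close>

lemma Sum_any_scale:
  assumes "k \<noteq> 0"
  shows "Sum_any (\<lambda>q. scale k (g q)) = scale k (Sum_any g)"
  using assms by (simp add: Sum_any.expand_set scale_sum_right)

lemma series3_mult_rescale:
  assumes "k \<noteq> 0" "\<And>q. scale (D' q) (F' (p - q)) = scale k (scale (D q) (F (p - q)))"
  shows "series3_mult scale D' F' p = scale k (series3_mult scale D F p)"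
  unfolding series3_mult_def assms(2) by (rule Sum_any_scale) fact

lemma delta_coeff_dilate_snd: "delta_coeff 1 (- c) l i j = c powi j * delta_coeff 1 (- 1) l i j"
  by (auto simp: delta_coeff_def binomial_coeff_def power_int_nonneg_exp
      power_mult_distrib[symmetric])

lemma delta_coeff_dilate_fst:
  "delta_coeff (- c) 1 l i j = c powi i * delta_coeff (- 1) 1 l i j"
  "delta_coeff c 1 l i j = c powi i * delta_coeff 1 1 l i j"
  by (auto simp: delta_coeff_def binomial_coeff_def power_int_mult_distrib[symmetric])

text \<open>The substitution of \<open>a x\<^sub>0\<close>, \<open>a x\<^sub>1\<close>, \<open>b x\<^sub>2\<close> for the three variables. It turns
  \<open>x\<^sub>1 - x\<^sub>2\<close> into \<open>a (x\<^sub>1 - (b / a) x\<^sub>2)\<close>, so the numerator and the denominator inside each delta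
  series scale together, and all three terms acquire the same prefactor \<open>a\<^sup>-\<^sup>1\<close>.\<close>

lemma jacobi_identity_dilate:
  assumes J: "jacobi_identity scale 1 A B Y C v"
    and "a \<noteq> 0" "b \<noteq> 0"
    and A: "\<And>n. Vector_Spaces.linear scale scale (A n)"
    and B: "\<And>n. Vector_Spaces.linear scale scale (B n)"
    and Y: "\<And>n w. Vector_Spaces.linear scale scale (\<lambda>u. Y u n w)"
  shows "jacobi_identity scale (b / a) (dilate scale a A) (dilate scale b B)
    (\<lambda>u. dilate scale b (Y u)) (dilate scale a C) v"
  unfolding jacobi_identity_def
proof (intro allI)
  fix w :: 'v and p :: "int \<times> int \<times> int"
  obtain p\<^sub>0 p\<^sub>1 p\<^sub>2 where p: "p = (p\<^sub>0, p\<^sub>1, p\<^sub>2)" by (cases p)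
  define c where "c = b / a"
  have c: "c \<noteq> 0" "b = c * a" using assms by (auto simp: c_def)
  define k where "k = c powi p\<^sub>2 * a powi (p\<^sub>0 + p\<^sub>1 + p\<^sub>2 + 1)"
  have "k \<noteq> 0" using c assms by (simp add: k_def)
  note lin = A[THEN linear_scale_eq] B[THEN linear_scale_eq]
    Y[THEN linear_scale_eq]
  \<comment> \<open>every term scales by the same monomial in \<open>a\<close> and \<open>c\<close>, since the exponents in the
    support of a delta series add up to \<open>- 1\<close>\<close>
  have factor: "c powi j * (a powi s * b powi t) = k"
    if "j + t = p\<^sub>2" "s + t = p\<^sub>0 + p\<^sub>1 + p\<^sub>2 + 1" for j s t
  proof -
    have "c powi j * (a powi s * b powi t) = c powi (j + t) * a powi (s + t)"
      using assms c by (simp add: power_int_add power_int_mult_distrib)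
    then show ?thesis by (simp only: that k_def)
  qed
  have L: "series3_mult scale (\<lambda>(n\<^sub>0, n\<^sub>1, n\<^sub>2). delta_coeff 1 (- c) n\<^sub>0 n\<^sub>1 n\<^sub>2)
       (\<lambda>(n\<^sub>0, n\<^sub>1, n\<^sub>2). if n\<^sub>0 = 0 then dilate scale a A n\<^sub>1 (dilate scale b B n\<^sub>2 w) else 0) p
     = scale k (series3_mult scale (\<lambda>(n\<^sub>0, n\<^sub>1, n\<^sub>2). delta_coeff 1 (- 1) n\<^sub>0 n\<^sub>1 n\<^sub>2)
       (\<lambda>(n\<^sub>0, n\<^sub>1, n\<^sub>2). if n\<^sub>0 = 0 then A n\<^sub>1 (B n\<^sub>2 w) else 0) p)"
  proof (rule series3_mult_rescale[OF \<open>k \<noteq> 0\<close>])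
    fix q :: "int \<times> int \<times> int"
    obtain q\<^sub>0 q\<^sub>1 q\<^sub>2 where q: "q = (q\<^sub>0, q\<^sub>1, q\<^sub>2)" by (cases q)
    show "scale (case q of (n\<^sub>0, n\<^sub>1, n\<^sub>2) \<Rightarrow> delta_coeff 1 (- c) n\<^sub>0 n\<^sub>1 n\<^sub>2)
       (case p - q of (n\<^sub>0, n\<^sub>1, n\<^sub>2) \<Rightarrow>
          if n\<^sub>0 = 0 then dilate scale a A n\<^sub>1 (dilate scale b B n\<^sub>2 w) else 0)
     = scale k (scale (case q of (n\<^sub>0, n\<^sub>1, n\<^sub>2) \<Rightarrow> delta_coeff 1 (- 1) n\<^sub>0 n\<^sub>1 n\<^sub>2)
       (case p - q of (n\<^sub>0, n\<^sub>1, n\<^sub>2) \<Rightarrow> if n\<^sub>0 = 0 then A n\<^sub>1 (B n\<^sub>2 w) else 0))"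
    proof (cases "q\<^sub>0 = p\<^sub>0 \<and> q\<^sub>1 + q\<^sub>2 = - q\<^sub>0 - 1")
      case True
      then show ?thesis
        using factor[of q\<^sub>2 "p\<^sub>2 - q\<^sub>2" "p\<^sub>1 - q\<^sub>1"]
        by (simp add: p q dilate_def lin delta_coeff_dilate_snd[of c] mult_ac)
    qed (auto simp: p q delta_coeff_eq_0)
  qed
  have M: "series3_mult scale (\<lambda>(n\<^sub>0, n\<^sub>1, n\<^sub>2). delta_coeff (- c) 1 n\<^sub>0 n\<^sub>2 n\<^sub>1)
       (\<lambda>(n\<^sub>0, n\<^sub>1, n\<^sub>2). if n\<^sub>0 = 0 then dilate scale b B n\<^sub>2 (dilate scale a A n\<^sub>1 w) else 0) p
     = scale k (series3_mult scale (\<lambda>(n\<^sub>0, n\<^sub>1, n\<^sub>2). delta_coeff (- 1) 1 n\<^sub>0 n\<^sub>2 n\<^sub>1)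
       (\<lambda>(n\<^sub>0, n\<^sub>1, n\<^sub>2). if n\<^sub>0 = 0 then B n\<^sub>2 (A n\<^sub>1 w) else 0) p)"
  proof (rule series3_mult_rescale[OF \<open>k \<noteq> 0\<close>])
    fix q :: "int \<times> int \<times> int"
    obtain q\<^sub>0 q\<^sub>1 q\<^sub>2 where q: "q = (q\<^sub>0, q\<^sub>1, q\<^sub>2)" by (cases q)
    show "scale (case q of (n\<^sub>0, n\<^sub>1, n\<^sub>2) \<Rightarrow> delta_coeff (- c) 1 n\<^sub>0 n\<^sub>2 n\<^sub>1)
       (case p - q of (n\<^sub>0, n\<^sub>1, n\<^sub>2) \<Rightarrow>
          if n\<^sub>0 = 0 then dilate scale b B n\<^sub>2 (dilate scale a A n\<^sub>1 w) else 0)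
     = scale k (scale (case q of (n\<^sub>0, n\<^sub>1, n\<^sub>2) \<Rightarrow> delta_coeff (- 1) 1 n\<^sub>0 n\<^sub>2 n\<^sub>1)
       (case p - q of (n\<^sub>0, n\<^sub>1, n\<^sub>2) \<Rightarrow> if n\<^sub>0 = 0 then B n\<^sub>2 (A n\<^sub>1 w) else 0))"
    proof (cases "q\<^sub>0 = p\<^sub>0 \<and> q\<^sub>2 + q\<^sub>1 = - q\<^sub>0 - 1")
      case True
      then show ?thesis
        using factor[of q\<^sub>2 "p\<^sub>2 - q\<^sub>2" "p\<^sub>1 - q\<^sub>1"]
        by (simp add: p q dilate_def lin delta_coeff_dilate_fst[of c] mult_ac)
    qed (auto simp: p q delta_coeff_eq_0)
  qed
  have N: "series3_mult scale (\<lambda>(n\<^sub>0, n\<^sub>1, n\<^sub>2). delta_coeff c 1 n\<^sub>1 n\<^sub>2 n\<^sub>0)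
       (\<lambda>(n\<^sub>0, n\<^sub>1, n\<^sub>2). if n\<^sub>1 = 0 then dilate scale b (Y (dilate scale a C n\<^sub>0 v)) n\<^sub>2 w else 0) p
     = scale k (series3_mult scale (\<lambda>(n\<^sub>0, n\<^sub>1, n\<^sub>2). delta_coeff 1 1 n\<^sub>1 n\<^sub>2 n\<^sub>0)
       (\<lambda>(n\<^sub>0, n\<^sub>1, n\<^sub>2). if n\<^sub>1 = 0 then Y (C n\<^sub>0 v) n\<^sub>2 w else 0) p)"
  proof (rule series3_mult_rescale[OF \<open>k \<noteq> 0\<close>])
    fix q :: "int \<times> int \<times> int"
    obtain q\<^sub>0 q\<^sub>1 q\<^sub>2 where q: "q = (q\<^sub>0, q\<^sub>1, q\<^sub>2)" by (cases q)
    show "scale (case q of (n\<^sub>0, n\<^sub>1, n\<^sub>2) \<Rightarrow> delta_coeff c 1 n\<^sub>1 n\<^sub>2 n\<^sub>0)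
       (case p - q of (n\<^sub>0, n\<^sub>1, n\<^sub>2) \<Rightarrow>
          if n\<^sub>1 = 0 then dilate scale b (Y (dilate scale a C n\<^sub>0 v)) n\<^sub>2 w else 0)
     = scale k (scale (case q of (n\<^sub>0, n\<^sub>1, n\<^sub>2) \<Rightarrow> delta_coeff 1 1 n\<^sub>1 n\<^sub>2 n\<^sub>0)
       (case p - q of (n\<^sub>0, n\<^sub>1, n\<^sub>2) \<Rightarrow> if n\<^sub>1 = 0 then Y (C n\<^sub>0 v) n\<^sub>2 w else 0))"
    proof (cases "q\<^sub>1 = p\<^sub>1 \<and> q\<^sub>2 + q\<^sub>0 = - q\<^sub>1 - 1")
      case True
      then show ?thesis
        using factor[of q\<^sub>2 "p\<^sub>2 - q\<^sub>2" "p\<^sub>0 - q\<^sub>0"]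
        by (simp add: p q dilate_def lin delta_coeff_dilate_fst(2)[of c] mult_ac)
    qed (auto simp: p q delta_coeff_eq_0)
  qed
  show "series3_mult scale (\<lambda>(n\<^sub>0, n\<^sub>1, n\<^sub>2). delta_coeff 1 (- (b / a)) n\<^sub>0 n\<^sub>1 n\<^sub>2)
       (\<lambda>(n\<^sub>0, n\<^sub>1, n\<^sub>2). if n\<^sub>0 = 0 then dilate scale a A n\<^sub>1 (dilate scale b B n\<^sub>2 w) else 0) p
     - series3_mult scale (\<lambda>(n\<^sub>0, n\<^sub>1, n\<^sub>2). delta_coeff (- (b / a)) 1 n\<^sub>0 n\<^sub>2 n\<^sub>1)
       (\<lambda>(n\<^sub>0, n\<^sub>1, n\<^sub>2). if n\<^sub>0 = 0 then dilate scale b B n\<^sub>2 (dilate scale a A n\<^sub>1 w) else 0) p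
     = series3_mult scale (\<lambda>(n\<^sub>0, n\<^sub>1, n\<^sub>2). delta_coeff (b / a) 1 n\<^sub>1 n\<^sub>2 n\<^sub>0)
       (\<lambda>(n\<^sub>0, n\<^sub>1, n\<^sub>2). if n\<^sub>1 = 0 then dilate scale b (Y (dilate scale a C n\<^sub>0 v)) n\<^sub>2 w else 0) p"
    unfolding c_def[symmetric] L M N scale_right_diff_distrib[symmetric]
    using J[unfolded jacobi_identity_def, rule_format, of w p] by (rule arg_cong)
qed

end

section \<open>From a \<open>\<Gamma>\<close>-vertex algebra to a representation\<close>

lemma character_inv:
  assumes "group G" "\<phi> \<in> hom G complex_units" "\<alpha> \<in> carrier G"
  shows "\<phi> \<one>\<^bsub>G\<^esub> = 1" "\<phi> \<alpha> \<noteq> 0" "\<phi> (inv\<^bsub>G\<^esub> \<alpha>) = inverse (\<phi> \<alpha>)"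
proof -
  interpret group G by fact
  have mult: "\<phi> (x \<otimes>\<^bsub>G\<^esub> y) = \<phi> x * \<phi> y" if "x \<in> carrier G" "y \<in> carrier G" for x y
    using assms(2) that by (simp add: hom_def complex_units_def)
  have nz: "\<phi> x \<noteq> 0" if "x \<in> carrier G" for x
    using assms(2) that by (auto simp: hom_def complex_units_def)
  show one: "\<phi> \<one>\<^bsub>G\<^esub> = 1" using mult[of "\<one>\<^bsub>G\<^esub>" "\<one>\<^bsub>G\<^esub>"] nz[of "\<one>\<^bsub>G\<^esub>"] by simp
  show "\<phi> \<alpha> \<noteq> 0" by (rule nz) fact
  show "\<phi> (inv\<^bsub>G\<^esub> \<alpha>) = inverse (\<phi> \<alpha>)"
    using mult[of "inv\<^bsub>G\<^esub> \<alpha>" \<alpha>] assms(3) one nz[of \<alpha>] by (simp add: field_simps)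
qed

lemma vacuum_action_eq: "vacuum_action Y vac \<alpha> v = Y \<alpha> v 0 vac"
  by (simp add: vacuum_action_def Res_def shift_def)

context gamma_vertex_algebra
begin

lemma linear_mode: "\<alpha> \<in> carrier \<Gamma> \<Longrightarrow> Vector_Spaces.linear scale scale (Y \<alpha> v n)"
  using Y_in by (auto simp: Hom_Laurent_def)

lemma mode_zero: "\<alpha> \<in> carrier \<Gamma> \<Longrightarrow> Y \<alpha> v n 0 = 0"
  using linear_mode[THEN linear_scale_eq, of \<alpha> v n 0 0] by simp

lemma creation_coeff:
  "\<alpha> \<in> carrier \<Gamma> \<Longrightarrow> n < 0 \<Longrightarrow> Y \<alpha> v n vac = 0"
  using creation by (auto simp: power_series_def)

text \<open>\<open>Y\<^sub>\<beta>(R\<^bsub>\<beta>\<inverse>\<alpha>\<^esub> u, x) = Y\<^sub>\<alpha>(u, \<beta>\<inverse>\<alpha> x)\<close>: the coefficient of \<open>x\<^sub>0\<^sup>0 x\<^sub>1\<^sup>-\<^sup>1\<close> in the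
  Jacobi identity with the vacuum as second vector.\<close>

lemma Y_vacuum_action:
  assumes \<alpha>: "\<alpha> \<in> carrier \<Gamma>" and \<beta>: "\<beta> \<in> carrier \<Gamma>"
  shows "Y \<beta> (vacuum_action Y vac (inv \<beta> \<otimes> \<alpha>) u) n w
    = scale (\<phi> (inv \<beta> \<otimes> \<alpha>) powi n) (Y \<alpha> u n w)"
proof -
  let ?c = "\<phi> (inv \<beta> \<otimes> \<alpha>)"
  have c: "?c \<noteq> 0" using character_inv[OF is_group char_hom] assms by simp
  have J: "series3_mult scale (\<lambda>(n\<^sub>0, n\<^sub>1, n\<^sub>2). delta_coeff 1 (- ?c) n\<^sub>0 n\<^sub>1 n\<^sub>2)
          (\<lambda>(n\<^sub>0, n\<^sub>1, n\<^sub>2). if n\<^sub>0 = 0 then Y \<alpha> u n\<^sub>1 (Y \<beta> vac n\<^sub>2 w) else 0) (0, - 1, n)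
        - series3_mult scale (\<lambda>(n\<^sub>0, n\<^sub>1, n\<^sub>2). delta_coeff (- ?c) 1 n\<^sub>0 n\<^sub>2 n\<^sub>1)
          (\<lambda>(n\<^sub>0, n\<^sub>1, n\<^sub>2). if n\<^sub>0 = 0 then Y \<beta> vac n\<^sub>2 (Y \<alpha> u n\<^sub>1 w) else 0) (0, - 1, n)
        = Y \<beta> (Y (inv \<beta> \<otimes> \<alpha>) u 0 vac) n w"
    using jacobi[OF \<alpha> \<beta>, of u vac] series3_mult_iterate_residue[OF vector_space_axioms]
    unfolding jacobi_identity_def by metis
  have id: "Y \<beta> vac n\<^sub>2 z = (if n\<^sub>2 = 0 then z else 0)" for n\<^sub>2 z
    using \<beta> by (rule vacuum)
  have if_arg: "Y \<alpha> u n\<^sub>1 (if n\<^sub>2 = 0 then w else 0) = (if n\<^sub>2 = 0 then Y \<alpha> u n\<^sub>1 w else 0)"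
    for n\<^sub>1 n\<^sub>2 :: int
    using \<alpha> by (simp add: mode_zero)
  show ?thesis
    using J
    unfolding id if_arg series3_mult_left_residue[OF vector_space_axioms]
      series3_mult_right_residue[OF vector_space_axioms c]
    by (simp add: vacuum_action_eq split: if_splits)
qed

text \<open>\<open>R\<^sub>\<beta> Y\<^bsub>\<beta>\<inverse>\<alpha>\<^esub>(u, x) = Y\<^sub>\<alpha>(u, x) R\<^sub>\<beta>\<close>: the coefficient of \<open>x\<^sub>1\<^sup>-\<^sup>1 x\<^sub>2\<^sup>0\<close> in the
  Jacobi identity applied to the vacuum.\<close>

lemma vacuum_action_intertwines:
  assumes \<alpha>: "\<alpha> \<in> carrier \<Gamma>" and \<beta>: "\<beta> \<in> carrier \<Gamma>"
  shows "vacuum_action Y vac \<beta> (Y (inv \<beta> \<otimes> \<alpha>) u n v) = Y \<alpha> u n (vacuum_action Y vac \<beta> v)"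
proof -
  let ?c = "\<phi> (inv \<beta> \<otimes> \<alpha>)"
  have "series3_mult scale (\<lambda>(n\<^sub>0, n\<^sub>1, n\<^sub>2). delta_coeff 1 (- ?c) n\<^sub>0 n\<^sub>1 n\<^sub>2)
          (\<lambda>(n\<^sub>0, n\<^sub>1, n\<^sub>2). if n\<^sub>0 = 0 then Y \<alpha> u n\<^sub>1 (Y \<beta> v n\<^sub>2 vac) else 0) (n, - 1, 0)
        - series3_mult scale (\<lambda>(n\<^sub>0, n\<^sub>1, n\<^sub>2). delta_coeff (- ?c) 1 n\<^sub>0 n\<^sub>2 n\<^sub>1)
          (\<lambda>(n\<^sub>0, n\<^sub>1, n\<^sub>2). if n\<^sub>0 = 0 then Y \<beta> v n\<^sub>2 (Y \<alpha> u n\<^sub>1 vac) else 0) (n, - 1, 0)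
        = Y \<beta> (Y (inv \<beta> \<otimes> \<alpha>) u n v) 0 vac"
    using jacobi[OF \<alpha> \<beta>, of u v] series3_mult_iterate_residue[OF vector_space_axioms]
    unfolding jacobi_identity_def by metis
  \<comment> \<open>both factors of the first term have only nonnegative powers of \<open>x\<^sub>2\<close>, so the coefficient
    of \<open>x\<^sub>2\<^sup>0\<close> has a single contribution\<close>
  moreover have "series3_mult scale (\<lambda>(n\<^sub>0, n\<^sub>1, n\<^sub>2). delta_coeff 1 (- ?c) n\<^sub>0 n\<^sub>1 n\<^sub>2)
          (\<lambda>(n\<^sub>0, n\<^sub>1, n\<^sub>2). if n\<^sub>0 = 0 then Y \<alpha> u n\<^sub>1 (Y \<beta> v n\<^sub>2 vac) else 0) (n, - 1, 0)
        = Y \<alpha> u n (Y \<beta> v 0 vac)"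
  proof (subst series3_mult_single[where r = "(n, - 1 - n, 0)"], goal_cases)
    case (1 q)
    obtain q\<^sub>0 q\<^sub>1 q\<^sub>2 where q: "q = (q\<^sub>0, q\<^sub>1, q\<^sub>2)" by (cases q)
    show ?case
    proof (cases "0 < q\<^sub>2")
      case True
      then show ?thesis using \<alpha> \<beta> by (simp add: q creation_coeff mode_zero)
    next
      case False
      then show ?thesis using 1 by (auto simp: q delta_coeff_eq_0)
    qed
  qed (simp add: delta_coeff_def binomial_coeff_def)
  \<comment> \<open>both factors of the second term have only nonnegative powers of \<open>x\<^sub>1\<close>, so there is no
    \<open>x\<^sub>1\<^sup>-\<^sup>1\<close>\<close>
  moreover have "series3_mult scale (\<lambda>(n\<^sub>0, n\<^sub>1, n\<^sub>2). delta_coeff (- ?c) 1 n\<^sub>0 n\<^sub>2 n\<^sub>1)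
          (\<lambda>(n\<^sub>0, n\<^sub>1, n\<^sub>2). if n\<^sub>0 = 0 then Y \<beta> v n\<^sub>2 (Y \<alpha> u n\<^sub>1 vac) else 0) (n, - 1, 0) = 0"
    unfolding series3_mult_def
  proof (rule trans[OF Sum_any.cong Sum_any.neutral])
    fix q :: "int \<times> int \<times> int"
    obtain q\<^sub>0 q\<^sub>1 q\<^sub>2 where q: "q = (q\<^sub>0, q\<^sub>1, q\<^sub>2)" by (cases q)
    show "scale (case q of (n\<^sub>0, n\<^sub>1, n\<^sub>2) \<Rightarrow> delta_coeff (- ?c) 1 n\<^sub>0 n\<^sub>2 n\<^sub>1)
       (case (n, - 1, 0) - q of (n\<^sub>0, n\<^sub>1, n\<^sub>2) \<Rightarrow>
          if n\<^sub>0 = 0 then Y \<beta> v n\<^sub>2 (Y \<alpha> u n\<^sub>1 vac) else 0) = 0"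
      using \<alpha> \<beta> by (cases "0 \<le> q\<^sub>1") (simp_all add: q creation_coeff mode_zero delta_coeff_eq_0)
  qed
  ultimately show ?thesis by (simp add: vacuum_action_eq)
qed

lemma vacuum_action_one: "vacuum_action Y vac \<one> v = v"
  using creation_limit by (simp add: vacuum_action_eq has_formal_limit_def)

lemma vacuum_action_mult:
  assumes "\<alpha> \<in> carrier \<Gamma>" "\<beta> \<in> carrier \<Gamma>"
  shows "vacuum_action Y vac (\<alpha> \<otimes> \<beta>) v = vacuum_action Y vac \<alpha> (vacuum_action Y vac \<beta> v)"
  using Y_vacuum_action[of "\<alpha> \<otimes> \<beta>" \<alpha> v 0 vac] assms
  by (simp add: vacuum_action_eq m_assoc[symmetric])

lemma vacuum_action_inv:
  assumes "\<alpha> \<in> carrier \<Gamma>"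
  shows "vacuum_action Y vac \<alpha> (vacuum_action Y vac (inv \<alpha>) v) = v"
    and "vacuum_action Y vac (inv \<alpha>) (vacuum_action Y vac \<alpha> v) = v"
  using vacuum_action_mult[of \<alpha> "inv \<alpha>" v] vacuum_action_mult[of "inv \<alpha>" \<alpha> v] assms
  by (simp_all add: vacuum_action_one)

lemma representation_vacuum_action: "Defs.representation \<Gamma> scale (vacuum_action Y vac)"
  unfolding Defs.representation_def
proof (rule homI)
  fix \<alpha> assume \<alpha>: "\<alpha> \<in> carrier \<Gamma>"
  have "vacuum_action Y vac \<alpha> = (\<lambda>v. Y \<alpha> v 0 vac)"
    by (rule ext) (rule vacuum_action_eq)
  moreover have "bij (vacuum_action Y vac \<alpha>)"
    using \<alpha> by (intro o_bij[of "vacuum_action Y vac (inv \<alpha>)"]) (auto simp: fun_eq_iff vacuum_action_inv)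
  ultimately show "vacuum_action Y vac \<alpha> \<in> carrier (GL scale)"
    using Y_linear[OF \<alpha>] by (simp add: GL_def)
qed (auto simp: GL_def fun_eq_iff vacuum_action_mult)

lemma Y_eq_conjugate:
  assumes "\<alpha> \<in> carrier \<Gamma>"
  shows "Y \<alpha> v = conjugate (vacuum_action Y vac \<alpha>) (Y \<one> v) (vacuum_action Y vac (inv \<alpha>))"
  using vacuum_action_intertwines[of \<alpha> \<alpha> v] assms
  by (simp add: conjugate_def fun_eq_iff vacuum_action_inv)

lemma Y_eq_dilate:
  assumes "\<alpha> \<in> carrier \<Gamma>"
  shows "Y \<alpha> v = dilate scale (\<phi> (inv \<alpha>)) (Y \<one> (vacuum_action Y vac \<alpha> v))"
proof -
  have "Y \<one> (vacuum_action Y vac \<alpha> v) n w = scale (\<phi> \<alpha> powi n) (Y \<alpha> v n w)" for n w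
    using Y_vacuum_action[of \<alpha> \<one> v n w] assms by simp
  then show ?thesis
    using character_inv[OF is_group char_hom assms]
    by (simp add: dilate_def fun_eq_iff power_int_inverse)
qed

lemma vertex_algebra_one: "vertex_algebra scale (Y \<one>) vac"
  unfolding vertex_algebra_def
proof (intro gamma_vertex_algebra.intro gamma_vertex_algebra_axioms.intro)
  fix u v
  show "jacobi_identity scale 1 (Y \<one> u) (Y \<one> v) (Y \<one>) (Y \<one> u) v"
    using jacobi[OF one_closed one_closed, of u v] character_inv(1)[OF is_group char_hom one_closed]
    by simp
qed (auto simp: Y_in Y_linear vacuum creation creation_limit vector_space_axioms hom_def
    complex_units_def)

lemma has_formal_limit_vacuum_action:
  "\<alpha> \<in> carrier \<Gamma> \<Longrightarrow> has_formal_limit (\<lambda>n. Y \<alpha> v n vac) (vacuum_action Y vac \<alpha> v)"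
  by (simp add: has_formal_limit_def creation vacuum_action_eq)

lemma vacuum_action_vac: "\<alpha> \<in> carrier \<Gamma> \<Longrightarrow> vacuum_action Y vac \<alpha> vac = vac"
  by (simp add: vacuum_action_eq vacuum)

end

section \<open>From a representation to a \<open>\<Gamma>\<close>-vertex algebra\<close>

lemma gamma_vertex_algebra_conjugate:
  fixes \<Gamma> :: "('g, 'r) monoid_scheme" (structure)
    and scale :: "complex \<Rightarrow> 'v::ab_group_add \<Rightarrow> 'v"
  assumes G: "group \<Gamma>" and \<phi>: "\<phi> \<in> hom \<Gamma> complex_units"
    and VA: "vertex_algebra scale Y vac"
    and rep: "representation \<Gamma> scale R"
    and Rvac: "\<And>\<alpha>. \<alpha> \<in> carrier \<Gamma> \<Longrightarrow> R \<alpha> vac = vac"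
    and cov: "\<And>\<alpha> v. \<alpha> \<in> carrier \<Gamma> \<Longrightarrow>
      conjugate (R \<alpha>) (Y v) (inv_into UNIV (R \<alpha>)) = dilate scale (\<phi> (inv \<alpha>)) (Y (R \<alpha> v))"
    and Y': "\<And>\<alpha> v. \<alpha> \<in> carrier \<Gamma> \<Longrightarrow> Y' \<alpha> v = conjugate (R \<alpha>) (Y v) (inv_into UNIV (R \<alpha>))"
  shows "gamma_vertex_algebra \<Gamma> \<phi> scale Y' vac"
proof -
  interpret group \<Gamma> by fact
  interpret V: gamma_vertex_algebra "singleton_group ()" "\<lambda>_. 1" scale "\<lambda>_. Y" vac
    using VA by (simp add: vertex_algebra_def)
  have lin: "Vector_Spaces.linear scale scale (R \<alpha>)" and bij: "bij (R \<alpha>)"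
    if "\<alpha> \<in> carrier \<Gamma>" for \<alpha>
    using rep that by (auto simp: Defs.representation_def hom_def GL_def)
  have mult: "R (\<alpha> \<otimes> \<beta>) v = R \<alpha> (R \<beta> v)" if "\<alpha> \<in> carrier \<Gamma>" "\<beta> \<in> carrier \<Gamma>" for \<alpha> \<beta> v
    using rep that by (auto simp: Defs.representation_def hom_def GL_def)
  have one: "R \<one> v = v" for v
    using mult[of \<one> \<one> v] bij[of \<one>] by (simp add: bij_def inj_eq)
  have inv_left: "R (inv \<alpha>) (R \<alpha> v) = v" and inv_right: "R \<alpha> (R (inv \<alpha>) v) = v"
    if "\<alpha> \<in> carrier \<Gamma>" for \<alpha> v
    using mult[of "inv \<alpha>" \<alpha> v] mult[of \<alpha> "inv \<alpha>" v] that by (simp_all add: one)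
  have Rinv: "inv_into UNIV (R \<alpha>) = R (inv \<alpha>)" if "\<alpha> \<in> carrier \<Gamma>" for \<alpha>
    using that by (intro Hilbert_Choice.inv_equality) (simp_all add: inv_left inv_right)
  have zero: "R \<alpha> 0 = 0" if "\<alpha> \<in> carrier \<Gamma>" for \<alpha>
    using lin[OF that, THEN linear_scale_eq, of 0 0] by simp
  have conj: "Y' \<alpha> v n w = R \<alpha> (Y v n (R (inv \<alpha>) w))" if "\<alpha> \<in> carrier \<Gamma>" for \<alpha> v n w
    using that by (simp add: Y' conjugate_def Rinv)
  have dil: "Y' \<alpha> v = dilate scale (\<phi> (inv \<alpha>)) (Y (R \<alpha> v))" if "\<alpha> \<in> carrier \<Gamma>" for \<alpha> v
    using that by (simp add: Y' cov)
  note linear_comp = Vector_Spaces.linear_compose[where ?s1.0 = scale and ?s2.0 = scale and ?s3.0 = scale]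
  show ?thesis
  proof (intro gamma_vertex_algebra.intro gamma_vertex_algebra_axioms.intro)
    show "group \<Gamma>" "\<phi> \<in> hom \<Gamma> complex_units" "vector_space scale"
      by (fact G \<phi> V.vector_space_axioms)+
  next
    fix \<alpha> v assume \<alpha>: "\<alpha> \<in> carrier \<Gamma>"
    have "Vector_Spaces.linear scale scale (R \<alpha> \<circ> (Y v n \<circ> R (inv \<alpha>)))" for n
      using \<alpha> by (intro linear_comp lin V.linear_mode) auto
    moreover have "Y' \<alpha> v n = R \<alpha> \<circ> (Y v n \<circ> R (inv \<alpha>))" for n
      using \<alpha> by (simp add: fun_eq_iff conj)
    moreover have "lower_truncated (\<lambda>n. Y' \<alpha> v n w)" for w
    proof -
      have "lower_truncated (\<lambda>n. Y v n (R (inv \<alpha>) w))"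
        using V.Y_in[of "()" v] by (auto simp: Hom_Laurent_def)
      then obtain N where "\<forall>n<N. Y v n (R (inv \<alpha>) w) = 0"
        by (auto simp: lower_truncated_def)
      then have "\<forall>n<N. Y' \<alpha> v n w = 0"
        using \<alpha> by (simp add: conj zero)
      then show ?thesis by (auto simp: lower_truncated_def)
    qed
    ultimately show "Y' \<alpha> v \<in> Hom_Laurent scale"
      by (simp add: Hom_Laurent_def)
  next
    fix \<alpha> n w assume \<alpha>: "\<alpha> \<in> carrier \<Gamma>"
    have "Vector_Spaces.linear scale scale (R \<alpha> \<circ> (\<lambda>v. Y v n (R (inv \<alpha>) w)))"
      using \<alpha> V.Y_linear[of "()"] by (intro linear_comp lin) auto
    then show "Vector_Spaces.linear scale scale (\<lambda>v. Y' \<alpha> v n w)"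
      using \<alpha> by (simp add: conj o_def)
  next
    fix \<alpha> n w assume \<alpha>: "\<alpha> \<in> carrier \<Gamma>"
    show "Y' \<alpha> vac n w = (if n = 0 then w else 0)"
      using \<alpha> V.vacuum[of "()"] by (simp add: conj zero inv_right)
  next
    fix \<alpha> v assume \<alpha>: "\<alpha> \<in> carrier \<Gamma>"
    show "power_series (\<lambda>n. Y' \<alpha> v n vac)"
      using \<alpha> V.creation_coeff[of "()"] by (simp add: power_series_def conj Rvac zero)
  next
    fix v
    show "has_formal_limit (\<lambda>n. Y' \<one> v n vac) v"
      using V.creation_limit[of v] by (simp add: conj one)
  next
    fix \<alpha> \<beta> u v assume \<alpha>: "\<alpha> \<in> carrier \<Gamma>" and \<beta>: "\<beta> \<in> carrier \<Gamma>"
    let ?\<gamma> = "inv \<beta> \<otimes> \<alpha>" and ?a = "\<phi> (inv \<alpha>)" and ?b = "\<phi> (inv \<beta>)"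
    have c: "\<phi> ?\<gamma> = ?b / ?a" "?a \<noteq> 0" "?b \<noteq> 0"
      using character_inv[OF G \<phi> \<alpha>] character_inv[OF G \<phi> \<beta>] \<phi> \<alpha> \<beta>
      by (simp_all add: hom_def complex_units_def divide_inverse mult.commute)
    have "jacobi_identity scale 1 (Y (R \<alpha> u)) (Y (R \<beta> v)) Y (Y (R \<alpha> u)) (R \<beta> v)"
      using V.jacobi[of "()" "()" "R \<alpha> u" "R \<beta> v"] by simp
    then have J: "jacobi_identity scale (?b / ?a) (dilate scale ?a (Y (R \<alpha> u)))
        (dilate scale ?b (Y (R \<beta> v))) (\<lambda>z. dilate scale ?b (Y z))
        (dilate scale ?a (Y (R \<alpha> u))) (R \<beta> v)"
      using c V.linear_mode[of "()"] V.Y_linear[of "()"]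
      by (intro jacobi_identity_dilate[OF V.vector_space_axioms]) auto
    \<comment> \<open>the covariance of \<open>Y\<close> moves \<open>R\<^sub>\<beta>\<close> through the inner operator\<close>
    have inner: "dilate scale ?a (Y (R \<alpha> u)) n (R \<beta> v) = R \<beta> (Y' ?\<gamma> u n v)" for n
    proof -
      have "inv ?\<gamma> = inv \<alpha> \<otimes> \<beta>" using \<alpha> \<beta> by (simp add: inv_mult_group)
      then show ?thesis
        using \<alpha> \<beta> by (simp add: dil[symmetric] conj mult inv_right)
    qed
    show "jacobi_identity scale (\<phi> ?\<gamma>) (Y' \<alpha> u) (Y' \<beta> v) (Y' \<beta>) (Y' ?\<gamma> u) v"
      using J unfolding jacobi_identity_def inner c(1) dil[OF \<alpha>] dil[OF \<beta>] .
  qed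
qed

theorem theorem6p6:
  fixes \<Gamma> :: "('g, 'r) monoid_scheme"
    and \<phi> :: "'g \<Rightarrow> complex"
    and scale :: "complex \<Rightarrow> 'v::ab_group_add \<Rightarrow> 'v"
  assumes "group \<Gamma>"
    and "\<phi> \<in> hom \<Gamma> complex_units"
  shows
    "(\<forall>Y vac R.
        gamma_vertex_algebra \<Gamma> \<phi> scale Y vac \<longrightarrow>
        R = vacuum_action Y vac \<longrightarrow>
          (\<forall>\<alpha>\<in>carrier \<Gamma>. \<forall>v. has_formal_limit (\<lambda>n. Y \<alpha> v n vac) (R \<alpha> v)) \<and>
          vertex_algebra scale (Y \<one>\<^bsub>\<Gamma>\<^esub>) vac \<and>
          representation \<Gamma> scale R \<and>
          (\<forall>\<alpha>\<in>carrier \<Gamma>. R \<alpha> vac = vac) \<and>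
          (\<forall>\<alpha>\<in>carrier \<Gamma>. \<forall>v.
             Y \<alpha> v = conjugate (R \<alpha>) (Y \<one>\<^bsub>\<Gamma>\<^esub> v) (R (inv\<^bsub>\<Gamma>\<^esub> \<alpha>)) \<and>
             Y \<alpha> v = dilate scale (\<phi> (inv\<^bsub>\<Gamma>\<^esub> \<alpha>)) (Y \<one>\<^bsub>\<Gamma>\<^esub> (R \<alpha> v))))
     \<and>
     (\<forall>Y vac R Y'.
        vertex_algebra scale Y vac \<longrightarrow>
        representation \<Gamma> scale R \<longrightarrow>
        (\<forall>\<alpha>\<in>carrier \<Gamma>. R \<alpha> vac = vac) \<longrightarrow>
        (\<forall>\<alpha>\<in>carrier \<Gamma>. \<forall>v.
           conjugate (R \<alpha>) (Y v) (inv_into UNIV (R \<alpha>))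
             = dilate scale (\<phi> (inv\<^bsub>\<Gamma>\<^esub> \<alpha>)) (Y (R \<alpha> v))) \<longrightarrow>
        (\<forall>\<alpha>\<in>carrier \<Gamma>. \<forall>v. Y' \<alpha> v = conjugate (R \<alpha>) (Y v) (inv_into UNIV (R \<alpha>))) \<longrightarrow>
          gamma_vertex_algebra \<Gamma> \<phi> scale Y' vac)"
proof (rule conjI; intro allI impI)
  fix Y :: "'g \<Rightarrow> 'v \<Rightarrow> ('v \<Rightarrow> 'v) series" and vac R
  assume "gamma_vertex_algebra \<Gamma> \<phi> scale Y vac" and R: "R = vacuum_action Y vac"
  then interpret gamma_vertex_algebra \<Gamma> \<phi> scale Y vac by simp
  show "(\<forall>\<alpha>\<in>carrier \<Gamma>. \<forall>v. has_formal_limit (\<lambda>n. Y \<alpha> v n vac) (R \<alpha> v)) \<and>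
      vertex_algebra scale (Y \<one>\<^bsub>\<Gamma>\<^esub>) vac \<and>
      Defs.representation \<Gamma> scale R \<and>
      (\<forall>\<alpha>\<in>carrier \<Gamma>. R \<alpha> vac = vac) \<and>
      (\<forall>\<alpha>\<in>carrier \<Gamma>. \<forall>v.
         Y \<alpha> v = conjugate (R \<alpha>) (Y \<one>\<^bsub>\<Gamma>\<^esub> v) (R (inv\<^bsub>\<Gamma>\<^esub> \<alpha>)) \<and>
         Y \<alpha> v = dilate scale (\<phi> (inv\<^bsub>\<Gamma>\<^esub> \<alpha>)) (Y \<one>\<^bsub>\<Gamma>\<^esub> (R \<alpha> v)))"
    unfolding R
    using has_formal_limit_vacuum_action vertex_algebra_one representation_vacuum_action
      vacuum_action_vac Y_eq_conjugate Y_eq_dilate by blast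
next
  fix Y :: "'v \<Rightarrow> ('v \<Rightarrow> 'v) series" and vac R Y'
  assume "vertex_algebra scale Y vac" "representation \<Gamma> scale R"
    "\<forall>\<alpha>\<in>carrier \<Gamma>. R \<alpha> vac = vac"
    "\<forall>\<alpha>\<in>carrier \<Gamma>. \<forall>v. conjugate (R \<alpha>) (Y v) (inv_into UNIV (R \<alpha>))
       = dilate scale (\<phi> (inv\<^bsub>\<Gamma>\<^esub> \<alpha>)) (Y (R \<alpha> v))"
    "\<forall>\<alpha>\<in>carrier \<Gamma>. \<forall>v. Y' \<alpha> v = conjugate (R \<alpha>) (Y v) (inv_into UNIV (R \<alpha>))"
  then show "gamma_vertex_algebra \<Gamma> \<phi> scale Y' vac"
    by (intro gamma_vertex_algebra_conjugate[OF assms, where Y = Y and R = R]) auto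
qed

end
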